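(* Let $n\ge 3$ be an integer. Consider a game to $n$ of pickleball doubles with hybrid rally scoring, modeled by the Markov chain described in the context. Let $p_A$ (resp., $p_B$) be the probability that Team $A$ (resp., Team $B$) wins a rally when serving. Assume that rallies are independent and $p_A+p_B>0$. Then $$f_n^\circ(p_A,p_B):=\mathrm{P}(\text{Team } A \text{ wins game to } n\mid \text{Team } A \text{ serves first})-\mathrm{P}(\text{Team } A \text{ wins game to } n\mid \text{Team } B \text{ serves first})$$ is a symmetric rational function of $(p_A,p_B)$ on $[0,1]\times[0,1]-\{(0,0)\}$. In the special case in which the teams are evenly matched, that is, $p_A=p_B=:x\in(0,1]$, $$f_n^\circ(x,x)=2\,\mathrm{P}(\text{first-serving team wins game to } n)-1.$$
   Context: Hybrid rally scoring chain (modified rally scoring with traditional doubles server rotation). Put $q_A:=1-p_A$, $q_B:=1-p_B$. The score set is $\Sigma_n=(\{0,1,\ldots,n-1\}\times\{0,1,\ldots,n-1\})\cup\{(n-1,n),(n,n-1)\}$. The state space consists of the $4n^2+8$ states $(i,j,k)$ with $(i,j)\in\Sigma_n$ and $k\in\{1,2,3,4\}$, together with two absorbing states, "Team $A$ wins" and "Team $B$ wins". In state $(i,j,k)$, Team $A$ has $i$ points, Team $B$ has $j$ points, and $k$ says that the server is Team $A$'s first server ($k=1$), Team $A$'s second server ($k=2$), Team $B$'s first server ($k=3$), or Team $B$'s second server ($k=4$). (The scores $(n-1,n-1)$, $(n-1,n)$, $(n,n-1)$ represent "deuce", "advantage Team $B$", "advantage Team $A$".) Effect of a point won by Team $A$ while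 serving at score $(i,j)$: if $i\le n-2$, the score becomes $(i+1,j)$; if $i=n-1$ and $j\le n-2$, Team $A$ wins; $(n-1,n-1)$ becomes $(n,n-1)$; $(n-1,n)$ becomes $(n-1,n-1)$; at $(n,n-1)$ Team $A$ wins. Effect of a point won by Team $B$ while serving at score $(i,j)$: if $j\le n-2$, the score becomes $(i,j+1)$; if $j=n-1$ and $i\le n-2$, Team $B$ wins; $(n-1,n-1)$ becomes $(n-1,n)$; $(n,n-1)$ becomes $(n-1,n-1)$; at $(n-1,n)$ Team $B$ wins. Effect of a rally won by the receiving team: if Team $B$ is receiving and wins the rally at score $(i,j)$, the score becomes $(i,j+1)$ if either ($i\le n-2$ and $j\le n-2$) or ($i=n-1$ and $j\le n-4$), and is unchanged otherwise. If Team $A$ is receiving and wins the rally at score $(i,j)$, the score becomes $(i+1,j)$ if either ($i\le n-2$ and $j\le n-2$) or ($j=n-1$ and $i\le n-4$), and is unchanged otherwise. Transitions (one step is one rally): from $(i,j,k)$ with $k\in\{1,2\}$, with probability $p_A$ Team $A$ wins the rally while serving, the score changes accordingly and $k$ is unchanged (unless the game ends); with probability $q_A$ Team $B$ wins the rally while receiving, the score changes accordingly and $k$ becomes $k+1$. From $(i,j,k)$ with $k\in\{3,4\}$, with probability $p_B$ Team $B$ wins the rally while serving, the score changes accordingly and $k$ is unchanged (unless the game ends); with probability $q_B$ Team $A$ wins the rally while receiving, the score changes accordingly and $k$ becomes $4$ if $k=3$, and $1$ if $k=4$. The initial state is $(0,0,2)$ if Team $A$ serves first and $(0,0,4)$ if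 Team $B$ serves first. "Team $A$ wins game to $n$" is the event that the chain is absorbed at "Team $A$ wins"; similarly for Team $B$. "Symmetric" means $f_n^\circ(p_A,p_B)=f_n^\circ(p_B,p_A)$. "Rational function on a set" means equal on that set to a quotient of two polynomials in $(p_A,p_B)$ with denominator nonvanishing on that set. When $p_A=p_B$, $\mathrm{P}(\text{first-serving team wins game to } n)$ denotes the common value of $\mathrm{P}(\text{Team } A \text{ wins}\mid \text{Team } A \text{ serves first})$ and $\mathrm{P}(\text{Team } B \text{ wins}\mid \text{Team } B \text{ serves first})$. *)

theory Defs
  imports "HOL-Probability.Probability" "HOL-Computational_Algebra.Polynomial"
begin

section \<open>The law of a homogeneous Markov chain\<close>

definition chain_kernel ::
    "('s \<Rightarrow> 's pmf) \<Rightarrow> 's \<Rightarrow> nat \<Rightarrow> (nat \<Rightarrow> 's) \<Rightarrow> 's measure" where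
  "chain_kernel K s t \<omega> =
     measure_pmf (case t of 0 \<Rightarrow> return_pmf s | Suc m \<Rightarrow> K (\<omega> m))"

lemma Ionescu_Tulcea_chain_kernel:
  "Ionescu_Tulcea (chain_kernel K s) (\<lambda>_. count_space UNIV)"
proof (rule Ionescu_Tulcea.intro)
  fix i
  show "chain_kernel K s i \<in> Pi\<^sub>M {0..<i} (\<lambda>_. count_space UNIV) \<rightarrow>\<^sub>M
          subprob_algebra (count_space UNIV)"
  proof (cases i)
    case 0
    have "measure_pmf (return_pmf s) \<in> space (subprob_algebra (count_space UNIV))"
      by (simp add: space_subprob_algebra measure_pmf.subprob_space_axioms)
    then show ?thesis using 0 by (simp add: chain_kernel_def[abs_def])
  next
    case (Suc m)
    have "(\<lambda>x. measure_pmf (K x)) \<in> count_space UNIV \<rightarrow>\<^sub>M subprob_algebra (count_space UNIV)"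
      by (simp add: space_subprob_algebra measure_pmf.subprob_space_axioms)
    moreover have "(\<lambda>\<omega>. \<omega> m) \<in> Pi\<^sub>M {0..<i} (\<lambda>_. count_space UNIV) \<rightarrow>\<^sub>M count_space UNIV"
      using Suc by (intro measurable_component_singleton) simp
    ultimately show ?thesis using Suc measurable_compose
      by (fastforce simp: chain_kernel_def[abs_def])
  qed
next
  fix i x
  show "prob_space (chain_kernel K s i x)"
    by (simp add: chain_kernel_def measure_pmf.prob_space_axioms)
qed

global_interpretation chain: Ionescu_Tulcea "chain_kernel K s" "\<lambda>_. count_space UNIV"
  for K :: "'s \<Rightarrow> 's pmf" and s
  by (rule Ionescu_Tulcea_chain_kernel)

text \<open>
  The law, on the space of trajectories, of the Markov chain with transition
  kernel \<open>K\<close> started at \<open>s\<close>, as given by the Ionescu-Tulcea theorem.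
  Lemma \<open>emeasure_chain_law_path\<close> below computes it on cylinder sets.
\<close>

definition chain_law :: "('s \<Rightarrow> 's pmf) \<Rightarrow> 's \<Rightarrow> (nat \<Rightarrow> 's) measure" where
  "chain_law K s = chain.PF.lim K s"

lemma space_chain_law [simp]: "space (chain_law K s) = UNIV"
  by (simp add: chain_law_def space_PiM)

lemma sets_chain_law [measurable_cong, simp]:
  "sets (chain_law K s) = sets (Pi\<^sub>M UNIV (\<lambda>_. count_space UNIV))"
  by (simp add: chain_law_def)

lemma singleton_sets_PiM_count_space:
  assumes "finite J"
  shows "{restrict x J} \<in> sets (Pi\<^sub>M J (\<lambda>_. count_space UNIV))"
proof -
  have "{restrict x J} = PiE J (\<lambda>i. {x i})"
    by (auto simp: PiE_def Pi_def extensional_def restrict_def fun_eq_iff)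
  then show ?thesis using assms by (simp add: sets_PiM_I_finite)
qed

lemma emeasure_C_Suc:
  "emeasure (chain.C K s 0 (Suc t) (\<lambda>_. undefined)) {restrict x {0..<Suc t}} =
  emeasure (chain.C K s 0 t (\<lambda>_. undefined)) {restrict x {0..<t}} *
   pmf (case t of 0 \<Rightarrow> return_pmf s | Suc m \<Rightarrow> K (x m)) (x t)"
proof -
  let ?M = "\<lambda>t. Pi\<^sub>M {0..<t} (\<lambda>_. count_space (UNIV::'a set))"
  let ?p = "case t of 0 \<Rightarrow> return_pmf s | Suc m \<Rightarrow> K (x m)"
  let ?u = "\<lambda>_. undefined :: 'a"
  have u: "?u \<in> space (?M 0)" by (simp add: space_PiM PiE_def extensional_def)
  have sp: "space (chain.C K s 0 t ?u) = space (?M t)"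
    using chain.space_C[OF u, of K s t] by simp
  have st: "sets (chain.C K s 0 t ?u) = sets (?M t)"
    using chain.sets_C[OF u, of K s t] by simp
  have ne: "space (chain.C K s 0 t ?u) \<noteq> {}" unfolding sp by (simp add: space_PiM PiE_eq_empty_iff)
  have sing: "{restrict x {0..<t}} \<in> sets (?M t)" for t
    by (rule singleton_sets_PiM_count_space) simp
  have eP: "emeasure (chain.eP K s t \<omega>) {restrict x {0..<Suc t}} =
     ennreal (pmf ?p (x t)) * indicator {restrict x {0..<t}} \<omega>" if w: "\<omega> \<in> space (?M t)" for \<omega>
  proof (cases "\<omega> = restrict x {0..<t}")
    case True
    have "fun_upd \<omega> t -` {restrict x {0..<Suc t}} = {x t}"
    proof (intro set_eqI iffI)
      fix v assume "v \<in> fun_upd \<omega> t -` {restrict x {0..<Suc t}}"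
      then have "fun_upd \<omega> t v t = restrict x {0..<Suc t} t" by simp
      then show "v \<in> {x t}" by simp
    qed (auto simp: True fun_eq_iff)
    moreover have "chain_kernel K s t \<omega> = measure_pmf ?p"
      unfolding True by (auto simp: chain_kernel_def split: nat.split)
    ultimately show ?thesis using True
      by (subst chain.emeasure_eP[OF w sing]) (simp add: emeasure_pmf_single)
  next
    case False
    obtain i where i: "\<omega> i \<noteq> restrict x {0..<t} i" using False by (auto simp: fun_eq_iff)
    have "i < t" using i w by (auto simp: space_PiM PiE_def extensional_def restrict_def split: if_splits)
    then have "fun_upd \<omega> t -` {restrict x {0..<Suc t}} = {}"
    proof (intro equals0I)
      fix v assume "v \<in> fun_upd \<omega> t -` {restrict x {0..<Suc t}}"
      then have "fun_upd \<omega> t v i = restrict x {0..<Suc t} i" by simp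
      then show False using i \<open>i < t\<close> by simp
    qed
    then show ?thesis using False
      by (subst chain.emeasure_eP[OF w sing]) simp
  qed
  have "emeasure (chain.C K s 0 (Suc t) ?u) {restrict x {0..<Suc t}} =
     (\<integral>\<^sup>+\<omega>. emeasure (chain.eP K s t \<omega>) {restrict x {0..<Suc t}} \<partial>chain.C K s 0 t ?u)"
    using chain.measurable_eP[of K s t]
    by (simp, subst emeasure_bind[OF ne _ sing]) (simp_all add: measurable_cong_sets[OF st refl])
  also have "\<dots> = (\<integral>\<^sup>+\<omega>. ennreal (pmf ?p (x t)) * indicator {restrict x {0..<t}} \<omega> \<partial>chain.C K s 0 t ?u)"
    by (intro nn_integral_cong eP) (simp add: sp)
  also have "\<dots> = ennreal (pmf ?p (x t)) * emeasure (chain.C K s 0 t ?u) {restrict x {0..<t}}"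
    by (rule nn_integral_cmult_indicator) (simp add: st sing)
  finally show ?thesis by (simp add: mult.commute)
qed

lemma emeasure_C_path:
  "emeasure (chain.C K s 0 (Suc t) (\<lambda>_. undefined)) {restrict x {0..<Suc t}} =
     ennreal (of_bool (x 0 = s) * (\<Prod>i<t. pmf (K (x i)) (x (Suc i))))"
proof (induction t)
  case 0
  show ?case
    by (subst emeasure_C_Suc) (auto simp: restrict_def indicator_def emeasure_return sets_PiM_empty space_PiM)
next
  case (Suc t)
  show ?case
    by (subst emeasure_C_Suc, subst Suc.IH) (simp add: mult.assoc prod_nonneg flip: ennreal_mult)
qed

lemma emeasure_chain_law_path:
  "emeasure (chain_law K s) {\<omega>. \<forall>i\<le>t. \<omega> i = x i} =
     ennreal (of_bool (x 0 = s) * (\<Prod>i<t. pmf (K (x i)) (x (Suc i))))"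
proof -
  let ?M = "\<lambda>J. Pi\<^sub>M J (\<lambda>_. count_space (UNIV::'a set))"
  have eq: "{\<omega>. \<forall>i\<le>t. \<omega> i = x i} = chain.PF.emb UNIV {0..<Suc t} {restrict x {0..<Suc t}}"
    by (auto simp: prod_emb_def space_PiM fun_eq_iff restrict_def) (metis less_Suc_eq_le)
  have emb: "chain.PF.emb {0..<Suc t} {0..<Suc t} {restrict x {0..<Suc t}} = {restrict x {0..<Suc t}}"
    by (rule prod_emb_id) (auto)
  show ?thesis
    unfolding chain_law_def eq
    by (simp add: chain.lim singleton_sets_PiM_count_space chain.emeasure_CI[OF subset_refl] emb
       emeasure_C_path del: chain.C.simps)
qed

lemma prob_space_chain_law: "prob_space (chain_law K s)"
proof
  have "emeasure (chain_law K s) (chain.PF.emb UNIV {} (space (Pi\<^sub>M {} (\<lambda>_. count_space UNIV)))) =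
      emeasure (chain.CI K s {}) (space (chain.CI K s {}))"
    unfolding chain_law_def by (subst chain.lim) (simp_all add: chain.CI_def)
  also have "\<dots> = 1"
    by (intro prob_space.emeasure_space_1 chain.PF.prob_space_P) auto
  finally show "emeasure (chain_law K s) (space (chain_law K s)) = 1"
    by (simp add: prod_emb_def space_PiM vimage_def restrict_def)
qed


section \<open>Pickleball doubles with hybrid rally scoring\<close>

datatype team = Team_A | Team_B

datatype server = A_first | A_second | B_first | B_second

text \<open>
  \<open>Play i j k\<close>: Team A has \<open>i\<close> points, Team B has \<open>j\<close> points, and \<open>k\<close> serves.
\<close>

datatype state = Play nat nat server | Wins team

definition score_set :: "nat \<Rightarrow> (nat \<times> nat) set" where
  "score_set n = {..<n} \<times> {..<n} \<union> {(n - 1, n), (n, n - 1)}"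

definition state_space :: "nat \<Rightarrow> state set" where
  "state_space n = {Play i j k |i j k. (i, j) \<in> score_set n} \<union> range Wins"

lemma Play_in_state_space [simp]: "Play i j k \<in> state_space n \<longleftrightarrow> (i, j) \<in> score_set n"
  by (auto simp: state_space_def)

lemma Wins_in_state_space [simp]: "Wins T \<in> state_space n"
  by (simp add: state_space_def)

fun next_server :: "server \<Rightarrow> server" where
  "next_server A_first = A_second"
| "next_server A_second = B_first"
| "next_server B_first = B_second"
| "next_server B_second = A_first"

text \<open>
  Score bounds such as \<open>i \<le> n - 2\<close> are stated without subtraction, since \<open>n - 4\<close> would be
  truncated for \<open>n = 3\<close>. On \<open>score_set n\<close>, the last case of \<open>A_scores_serving\<close> is the score
  \<open>(n, n - 1)\<close>, and that of \<open>B_scores_serving\<close> is \<open>(n - 1, n)\<close>.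
\<close>

definition A_scores_serving :: "nat \<Rightarrow> nat \<Rightarrow> nat \<Rightarrow> server \<Rightarrow> state" where
  "A_scores_serving n i j k =
     (if i + 2 \<le> n then Play (i + 1) j k
      else if i + 1 = n \<and> j + 2 \<le> n then Wins Team_A
      else if i + 1 = n \<and> j + 1 = n then Play n (n - 1) k
      else if i + 1 = n \<and> j = n then Play (n - 1) (n - 1) k
      else Wins Team_A)"

definition B_scores_serving :: "nat \<Rightarrow> nat \<Rightarrow> nat \<Rightarrow> server \<Rightarrow> state" where
  "B_scores_serving n i j k =
     (if j + 2 \<le> n then Play i (j + 1) k
      else if j + 1 = n \<and> i + 2 \<le> n then Wins Team_B
      else if i + 1 = n \<and> j + 1 = n then Play (n - 1) n k
      else if i = n \<and> j + 1 = n then Play (n - 1) (n - 1) k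
      else Wins Team_B)"

definition A_wins_receiving :: "nat \<Rightarrow> nat \<Rightarrow> nat \<Rightarrow> server \<Rightarrow> state" where
  "A_wins_receiving n i j k =
     (if (i + 2 \<le> n \<and> j + 2 \<le> n) \<or> (j + 1 = n \<and> i + 4 \<le> n)
      then Play (i + 1) j (next_server k) else Play i j (next_server k))"

definition B_wins_receiving :: "nat \<Rightarrow> nat \<Rightarrow> nat \<Rightarrow> server \<Rightarrow> state" where
  "B_wins_receiving n i j k =
     (if (i + 2 \<le> n \<and> j + 2 \<le> n) \<or> (i + 1 = n \<and> j + 4 \<le> n)
      then Play i (j + 1) (next_server k) else Play i j (next_server k))"

text \<open>
  The kernel has its intended meaning only for \<open>pA\<close> and \<open>pB\<close> in the unit interval
  (\<open>bernoulli_pmf\<close> truncates its parameter). The Boolean says whether the server wins the rally.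
\<close>

fun rally :: "nat \<Rightarrow> real \<Rightarrow> real \<Rightarrow> state \<Rightarrow> state pmf" where
  "rally n pA pB (Play i j k) =
     (if k \<in> {A_first, A_second}
      then map_pmf (\<lambda>w. if w then A_scores_serving n i j k else B_wins_receiving n i j k)
             (bernoulli_pmf pA)
      else map_pmf (\<lambda>w. if w then B_scores_serving n i j k else A_wins_receiving n i j k)
             (bernoulli_pmf pB))"
| "rally n pA pB (Wins T) = return_pmf (Wins T)"

lemma card_state_space:
  assumes "n \<ge> 1"
  shows "card (state_space n) = 4 * n\<^sup>2 + 8 + 2"
proof -
  have UNIV_server: "(UNIV :: server set) = {A_first, A_second, B_first, B_second}"
    using server.exhaust by blast
  have UNIV_team: "(UNIV :: team set) = {Team_A, Team_B}"
    using team.exhaust by blast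
  have *: "state_space n =
      (\<lambda>(p, k). Play (fst p) (snd p) k) ` (score_set n \<times> UNIV) \<union> {Wins Team_A, Wins Team_B}"
  proof (rule set_eqI)
    fix s
    show "s \<in> state_space n \<longleftrightarrow> s \<in> (\<lambda>(p, k). Play (fst p) (snd p) k) ` (score_set n \<times> UNIV) \<union>
        {Wins Team_A, Wins Team_B}"
    proof (cases s)
      case (Play i j k)
      show ?thesis unfolding Play by (auto intro!: image_eqI[of _ _ "((i, j), k)"])
    next
      case (Wins T)
      then show ?thesis by (cases T) auto
    qed
  qed
  have "card (score_set n) = n\<^sup>2 + 2"
    using assms unfolding score_set_def
    by (subst card_Un_disjoint) (auto simp: power2_eq_square)
  then have "card ((\<lambda>(p, k). Play (fst p) (snd p) k) ` (score_set n \<times> UNIV)) = 4 * n\<^sup>2 + 8"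
    by (subst card_image) (auto simp: inj_on_def UNIV_server card_cartesian_product)
  moreover have "finite (score_set n)" by (simp add: score_set_def)
  ultimately show ?thesis
    unfolding * by (subst card_Un_disjoint) (auto simp: UNIV_server)
qed

lemma set_pmf_rally_subset:
  assumes "n \<ge> 2" and "s \<in> state_space n"
  shows "set_pmf (rally n pA pB s) \<subseteq> state_space n"
proof (cases s)
  case (Play i j k)
  then have ij: "i < n \<and> j < n \<or> i = n - 1 \<and> j = n \<or> i = n \<and> j = n - 1"
    using assms(2) by (simp add: score_set_def) blast
  have "A_scores_serving n i j k' \<in> state_space n" "B_scores_serving n i j k' \<in> state_space n"
    "A_wins_receiving n i j k' \<in> state_space n" "B_wins_receiving n i j k' \<in> state_space n" for k'
    using ij assms(1)
    by (auto simp: A_scores_serving_def B_scores_serving_def A_wins_receiving_def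
        B_wins_receiving_def score_set_def)
  then show ?thesis unfolding Play by auto
qed (use assms in simp)

text \<open>The first serving team starts with its second server.\<close>

fun initial_state :: "team \<Rightarrow> state" where
  "initial_state Team_A = Play 0 0 A_second"
| "initial_state Team_B = Play 0 0 B_second"

text \<open>The probability that team \<open>T\<close> wins the game to \<open>n\<close> if team \<open>S\<close> serves first.\<close>

definition win_prob :: "nat \<Rightarrow> real \<Rightarrow> real \<Rightarrow> team \<Rightarrow> team \<Rightarrow> real" where
  "win_prob n pA pB T S =
     \<P>(\<omega> in chain_law (rally n pA pB) (initial_state S). \<exists>t. \<omega> t = Wins T)"

definition f_circ :: "nat \<Rightarrow> real \<Rightarrow> real \<Rightarrow> real" where
  "f_circ n pA pB = win_prob n pA pB Team_A Team_A - win_prob n pA pB Team_A Team_B"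


section \<open>Rational functions of two variables\<close>

text \<open>
  A polynomial in two variables is a polynomial in \<open>y\<close> whose coefficients are polynomials in \<open>x\<close>.
\<close>

definition eval2 :: "real poly poly \<Rightarrow> real \<Rightarrow> real \<Rightarrow> real" where
  "eval2 P x y = poly (poly P [:y:]) x"

definition rational_function_on :: "(real \<times> real) set \<Rightarrow> (real \<Rightarrow> real \<Rightarrow> real) \<Rightarrow> bool" where
  "rational_function_on S f \<longleftrightarrow>
     (\<exists>P Q. \<forall>(x, y)\<in>S. eval2 Q x y \<noteq> 0 \<and> f x y = eval2 P x y / eval2 Q x y)"

end

theory Submission
  imports Defs "Jordan_Normal_Form.Determinant"
begin

text \<open>
  The probability of absorption at a given winner, as a function of the starting state, is harmonic
  for the rally kernel (first-step analysis). For \<open>(pA, pB) \<noteq> (0, 0)\<close> a maximum principle shows that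
  a harmonic function is determined by its values at the two absorbing states: from every state some
  team with a positive serving probability eventually serves with positive probability, and then wins
  by serving out the game. Uniqueness has three consequences. The two absorption probabilities add up
  to 1; exchanging the teams exchanges \<open>pA\<close> and \<open>pB\<close>; and the linear system for the absorption
  probabilities, whose coefficients are polynomials in \<open>pA\<close> and \<open>pB\<close>, has nonvanishing determinant, so
  Cramer's rule gives rationality. Writing \<open>XY\<close> for the probability that \<open>X\<close> wins when \<open>Y\<close> serves
  first, the symmetry is \<open>BB - BA = (1 - AB) - (1 - AA) = AA - AB\<close>.
\<close>

section \<open>First-step analysis\<close>

text \<open>\<open>chain_law\<close> is built by appending steps at the end of a path. This discrete
  law of the first \<open>t + 1\<close> states recurses on the first step instead, the form that
  first-step analysis needs.\<close>

primrec path_pmf :: "('s \<Rightarrow> 's pmf) \<Rightarrow> nat \<Rightarrow> 's \<Rightarrow> 's list pmf" where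
  "path_pmf K 0 s = return_pmf [s]"
| "path_pmf K (Suc t) s = bind_pmf (K s) (\<lambda>s'. map_pmf (Cons s) (path_pmf K t s'))"

lemma pmf_path_pmf:
  "pmf (path_pmf K t s) xs =
     of_bool (length xs = Suc t \<and> xs ! 0 = s) * (\<Prod>i<t. pmf (K (xs ! i)) (xs ! Suc i))"
proof (induction t arbitrary: s xs)
  case 0
  show ?case by (cases xs) (auto simp: indicator_def)
next
  case (Suc t)
  show ?case
  proof (cases "\<exists>ys. xs = s # ys")
    case True
    then obtain ys where xs: "xs = s # ys" by blast
    let ?q = "of_bool (length ys = Suc t) * (\<Prod>i<t. pmf (K (ys ! i)) (ys ! Suc i))"
    have "pmf (path_pmf K (Suc t) s) xs =
        measure_pmf.expectation (K s) (\<lambda>s'. pmf (path_pmf K t s') ys)"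
      unfolding xs path_pmf.simps pmf_bind by (subst pmf_map_inj') auto
    \<comment> \<open>A path from \<open>s'\<close> equals \<open>ys\<close> only if
      \<open>s'\<close> is its head, so the average over \<open>s'\<close> collapses to a single
      transition probability.\<close>
    also have "\<dots> = measure_pmf.expectation (K s) (\<lambda>s'. ?q * indicator {ys ! 0} s')"
      by (intro Bochner_Integration.integral_cong) (auto simp: Suc.IH indicator_def)
    also have "\<dots> = ?q * pmf (K s) (ys ! 0)"
      by (simp add: pmf.rep_eq)
    also have "\<dots> = of_bool (length xs = Suc (Suc t) \<and> xs ! 0 = s) *
        (\<Prod>i<Suc t. pmf (K (xs ! i)) (xs ! Suc i))"
      unfolding prod.lessThan_Suc_shift xs by (cases ys) auto
    finally show ?thesis .
  next
    case False
    then have "xs \<notin> set_pmf (path_pmf K (Suc t) s)" by auto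
    then have "pmf (path_pmf K (Suc t) s) xs = 0" by (simp only: set_pmf_iff not_not)
    moreover have "\<not> (length xs = Suc (Suc t) \<and> xs ! 0 = s)"
      using False by (cases xs) auto
    ultimately show ?thesis by simp
  qed
qed

lemma measurable_path_prefix [measurable]:
  "(\<lambda>\<omega>. map \<omega> [0..<t]) \<in> Pi\<^sub>M UNIV (\<lambda>_. count_space UNIV) \<rightarrow>\<^sub>M
     count_space (UNIV :: 's :: countable list set)"
  by (induction t) auto

text \<open>Bridges the two constructions: the state lists form a countable type, so it suffices to
  compare singletons, where both sides are the same product of transition probabilities.\<close>

lemma distr_chain_law_prefix:
  fixes K :: "'s :: countable \<Rightarrow> 's pmf"
  shows "distr (chain_law K s) (count_space UNIV) (\<lambda>\<omega>. map \<omega> [0..<Suc t]) =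
    measure_pmf (path_pmf K t s)"
proof (rule measure_eqI_countable[of _ UNIV])
  fix xs :: "'s list"
  have vim: "(\<lambda>\<omega>. map \<omega> [0..<Suc t]) -` {xs} =
      (if length xs = Suc t then {\<omega>. \<forall>i\<le>t. \<omega> i = xs ! i} else {})"
  proof (cases "length xs = Suc t")
    case True
    then have "map \<omega> [0..<Suc t] = xs \<longleftrightarrow> (\<forall>i\<le>t. \<omega> i = xs ! i)" for \<omega>
      unfolding list_eq_iff_nth_eq by (simp add: less_Suc_eq_le del: upt_Suc)
    with True show ?thesis by (simp add: vimage_def del: upt_Suc)
  qed auto
  show "emeasure (distr (chain_law K s) (count_space UNIV) (\<lambda>\<omega>. map \<omega> [0..<Suc t])) {xs} =
      emeasure (measure_pmf (path_pmf K t s)) {xs}"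
    using measurable_path_prefix[of "Suc t", where 's='s]
    by (subst emeasure_distr)
      (auto simp: vim emeasure_chain_law_path emeasure_pmf_single pmf_path_pmf
        measurable_cong_sets[OF sets_chain_law refl] simp del: upt_Suc)
qed auto

section \<open>Hitting probabilities as limits over finite horizons\<close>

definition hit_prob :: "('s \<Rightarrow> 's pmf) \<Rightarrow> 's \<Rightarrow> 's \<Rightarrow> real" where
  "hit_prob K c s = \<P>(\<omega> in chain_law K s. \<exists>t. \<omega> t = c)"

definition hit_within :: "('s \<Rightarrow> 's pmf) \<Rightarrow> 's \<Rightarrow> nat \<Rightarrow> 's \<Rightarrow> ennreal" where
  "hit_within K c t s = emeasure (path_pmf K t s) {xs. c \<in> set xs}"

lemma start_in_path_pmf: "xs \<in> set_pmf (path_pmf K t s) \<Longrightarrow> s \<in> set xs"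
  by (cases t) auto

lemma hit_within_target: "hit_within K c t c = 1"
proof -
  have "measure_pmf.prob (path_pmf K t c) {xs. c \<in> set xs} = 1"
    by (subst measure_pmf.prob_eq_1) (auto simp: AE_measure_pmf_iff start_in_path_pmf)
  then show ?thesis by (simp add: hit_within_def measure_pmf.emeasure_eq_measure)
qed

text \<open>The head \<open>s\<close> of the path is not the target, so only the remaining
  \<open>t\<close> steps can hit it.\<close>

lemma hit_within_Suc:
  assumes "s \<noteq> c"
  shows "hit_within K c (Suc t) s = (\<integral>\<^sup>+ s'. hit_within K c t s' \<partial>K s)"
  using assms by (simp add: hit_within_def emeasure_bind_pmf vimage_def)

lemma hit_within_eq_chain_law:
  fixes K :: "'s :: countable \<Rightarrow> 's pmf"
  shows "hit_within K c t s = emeasure (chain_law K s) {\<omega>. \<exists>i\<le>t. \<omega> i = c}"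
proof -
  have "(\<lambda>\<omega>. map \<omega> [0..<Suc t]) -` {xs. c \<in> set xs} = {\<omega>. \<exists>i\<le>t. \<omega> i = c}"
    by (force simp: image_iff less_Suc_eq_le simp del: upt_Suc)
  then show ?thesis
    unfolding hit_within_def distr_chain_law_prefix[symmetric]
    using measurable_path_prefix[of "Suc t", where 's='s]
    by (subst emeasure_distr) (auto simp: measurable_cong_sets[OF sets_chain_law refl] simp del: upt_Suc)
qed

lemma sets_hit_within: "{\<omega>. \<exists>i\<le>t. \<omega> i = c} \<in> sets (chain_law K (s :: 's))"
proof -
  have "{\<omega> \<in> space (Pi\<^sub>M UNIV (\<lambda>_. count_space (UNIV :: 's set))). \<exists>i\<le>t. \<omega> i = c} \<in>
    sets (Pi\<^sub>M UNIV (\<lambda>_. count_space UNIV))"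
    by measurable
  then show ?thesis by (simp add: space_PiM)
qed

lemma incseq_hit: "incseq (\<lambda>t. {\<omega>. \<exists>i\<le>t. \<omega> i = c})"
  by (auto simp: incseq_def intro: le_trans)

text \<open>Continuity from below along the increasing events of hitting \<open>c\<close> by time
  \<open>t\<close>.\<close>

lemma hit_prob_eq_SUP:
  fixes K :: "'s :: countable \<Rightarrow> 's pmf"
  shows "ennreal (hit_prob K c s) = (SUP t. hit_within K c t s)"
proof -
  interpret prob_space "chain_law K s" by (rule prob_space_chain_law)
  have eq: "{\<omega> :: nat \<Rightarrow> 's. \<exists>t. \<omega> t = c} = (\<Union>t. {\<omega>. \<exists>i\<le>t. \<omega> i = c})"
    by blast
  have "(SUP t. hit_within K c t s) = emeasure (chain_law K s) {\<omega>. \<exists>t. \<omega> t = c}"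
    unfolding hit_within_eq_chain_law eq
    by (rule SUP_emeasure_incseq[OF _ incseq_hit]) (rule image_subsetI, rule sets_hit_within)
  then show ?thesis by (simp add: hit_prob_def emeasure_eq_measure)
qed

lemma incseq_hit_within:
  fixes K :: "'s :: countable \<Rightarrow> 's pmf"
  shows "incseq (\<lambda>t. hit_within K c t s)"
  unfolding hit_within_eq_chain_law
  by (rule monoI, rule emeasure_mono[OF monoD[OF incseq_hit] sets_hit_within])

lemma hit_prob_nonneg: "hit_prob K c s \<ge> 0" and hit_prob_le_1: "hit_prob K c s \<le> 1"
  using prob_space.prob_le_1[OF prob_space_chain_law] by (auto simp: hit_prob_def)

lemma hit_prob_target:
  fixes K :: "'s :: countable \<Rightarrow> 's pmf"
  shows "hit_prob K c c = 1"
  using hit_prob_eq_SUP[of K c c] by (simp add: hit_within_target)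

lemma hit_prob_absorbing:
  fixes K :: "'s :: countable \<Rightarrow> 's pmf"
  assumes "K s = return_pmf s" "s \<noteq> c"
  shows "hit_prob K c s = 0"
proof -
  have "hit_within K c t s = 0" for t
  proof (induction t)
    case 0
    show ?case using assms(2) by (simp add: hit_within_def indicator_def)
  next
    case (Suc t)
    then show ?case using assms by (simp add: hit_within_Suc)
  qed
  then show ?thesis using hit_prob_eq_SUP[of K c s] hit_prob_nonneg[of K c s] by simp
qed

text \<open>Let the horizon in \<open>hit_within_Suc\<close> tend to infinity, exchanging supremum
  and integral by monotone convergence.\<close>

lemma hit_prob_first_step:
  fixes K :: "'s :: countable \<Rightarrow> 's pmf"
  assumes "s \<noteq> c"
  shows "hit_prob K c s = measure_pmf.expectation (K s) (hit_prob K c)"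
proof -
  have inc: "hit_within K c t s' \<le> hit_within K c (Suc t) s'" for t s'
    using incseq_hit_within[of K c s'] by (rule incseq_SucD)
  have "ennreal (hit_prob K c s) = (SUP t. hit_within K c (Suc t) s)"
    unfolding hit_prob_eq_SUP using inc[of _ s] by (intro SUP_eq) blast+
  also have "\<dots> = (SUP t. \<integral>\<^sup>+ s'. hit_within K c t s' \<partial>K s)"
    using assms by (simp add: hit_within_Suc)
  also have "\<dots> = (\<integral>\<^sup>+ s'. (SUP t. hit_within K c t s') \<partial>K s)"
    using inc by (intro nn_integral_monotone_convergence_SUP[symmetric] incseq_SucI le_funI) auto
  also have "\<dots> = (\<integral>\<^sup>+ s'. ennreal (hit_prob K c s') \<partial>K s)"
    by (simp add: hit_prob_eq_SUP)
  also have "\<dots> = ennreal (measure_pmf.expectation (K s) (hit_prob K c))"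
    by (intro nn_integral_eq_integral measure_pmf.integrable_const_bound[where B=1])
      (auto simp: hit_prob_nonneg hit_prob_le_1)
  finally show ?thesis
    by (simp add: hit_prob_nonneg integral_nonneg_AE)
qed


section \<open>Rational functions and linear systems\<close>

lemma comm_ring_hom_eval2: "comm_ring_hom (\<lambda>P. eval2 P x y)"
  by unfold_locales (simp_all add: eval2_def)

lemma eval2_simps [simp]:
  "eval2 0 x y = 0" "eval2 1 x y = 1" "eval2 (P + Q) x y = eval2 P x y + eval2 Q x y"
  "eval2 (P - Q) x y = eval2 P x y - eval2 Q x y" "eval2 (P * Q) x y = eval2 P x y * eval2 Q x y"
  "eval2 [:[:0, 1:]:] x y = x" "eval2 [:0, 1:] x y = y"
  by (simp_all add: eval2_def)

lemma eval2_of_bool [simp]: "eval2 (of_bool b) x y = of_bool b"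
  by (cases b) simp_all

lemma rational_function_on_diff:
  assumes "rational_function_on S f" "rational_function_on S g"
  shows "rational_function_on S (\<lambda>x y. f x y - g x y)"
proof -
  obtain P Q P' Q' where
    *: "\<And>x y. (x, y) \<in> S \<Longrightarrow> eval2 Q x y \<noteq> 0 \<and> f x y = eval2 P x y / eval2 Q x y"
       "\<And>x y. (x, y) \<in> S \<Longrightarrow> eval2 Q' x y \<noteq> 0 \<and> g x y = eval2 P' x y / eval2 Q' x y"
    using assms unfolding rational_function_on_def by fast
  show ?thesis unfolding rational_function_on_def
    by (rule exI[of _ "P * Q' - P' * Q"], rule exI[of _ "Q * Q'"]) (use * in \<open>auto simp: diff_frac_eq\<close>)
qed

text \<open>Cramer's rule over the polynomial ring. Both determinants are polynomials chosen before
  the point \<open>(x, y)\<close>, so one quotient serves all of \<open>S\<close>;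
  \<open>uniq\<close> keeps the denominator from vanishing there.\<close>

lemma rational_solution_of_linear_system:
  fixes a :: "'s \<Rightarrow> 's \<Rightarrow> real poly poly" and b :: "'s \<Rightarrow> real poly poly"
  assumes fin: "finite X" and s: "s \<in> X"
    and sol: "\<And>x y r. (x, y) \<in> S \<Longrightarrow> r \<in> X \<Longrightarrow>
      (\<Sum>t\<in>X. eval2 (a r t) x y * v x y t) = eval2 (b r) x y"
    and uniq: "\<And>x y w. (x, y) \<in> S \<Longrightarrow>
      (\<And>r. r \<in> X \<Longrightarrow> (\<Sum>t\<in>X. eval2 (a r t) x y * w t) = 0) \<Longrightarrow> (\<And>r. r \<in> X \<Longrightarrow> w r = 0)"
  shows "rational_function_on S (\<lambda>x y. v x y s)"
proof -
  define N where "N = card X"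
  obtain e where e: "bij_betw e {0..<N} X"
    using ex_bij_betw_nat_finite[OF fin] unfolding N_def by blast
  obtain k where k: "k < N" "e k = s"
    using e s unfolding bij_betw_def by force
  define A where "A = mat N N (\<lambda>(i, j). a (e i) (e j))"
  define R where "R = replace_col A (Matrix.vec N (\<lambda>i. b (e i))) k"
  have sum_e: "(\<Sum>t\<in>X. g t) = (\<Sum>i<N. g (e i))" for g :: "'s \<Rightarrow> real"
    using sum.reindex_bij_betw[OF e, of g] by (simp add: lessThan_atLeast0)
  have eX: "e i \<in> X" if "i < N" for i using e that by (auto simp: bij_betw_def)
  show ?thesis
    unfolding rational_function_on_def
  proof (rule exI[of _ "Determinant.det R"], rule exI[of _ "Determinant.det A"], safe)
    fix x y assume xy: "(x, y) \<in> S"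
    \<comment> \<open>Evaluation at \<open>(x, y)\<close> is a ring homomorphism, so it commutes
      with determinants.\<close>
    interpret comm_ring_hom "\<lambda>P. eval2 P x y" by (rule comm_ring_hom_eval2)
    define B where "B = map_mat (\<lambda>P. eval2 P x y) A"
    have B: "B \<in> carrier_mat N N" by (simp add: B_def A_def)
    have mult: "B *\<^sub>v u = Matrix.vec N (\<lambda>i. \<Sum>j<N. eval2 (a (e i) (e j)) x y * vec_index u j)"
      if "u \<in> carrier_vec N" for u
      using that by (intro eq_vecI) (auto simp: B_def A_def scalar_prod_def lessThan_atLeast0)
    show nz: False if "eval2 (Determinant.det A) x y = 0"
    proof -
      have "Determinant.det B = 0" using that by (simp add: B_def)
      then obtain u where u: "u \<in> carrier_vec N" "u \<noteq> 0\<^sub>v N" "B *\<^sub>v u = 0\<^sub>v N"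
        using det_0_iff_vec_prod_zero[OF B] by blast
      \<comment> \<open>A singular matrix has a nonzero kernel vector; read back along the
        enumeration \<open>e\<close>, it is a nonzero homogeneous solution on \<open>X\<close>,
        against \<open>uniq\<close>.\<close>
      define w where "w t = vec_index u (the_inv_into {0..<N} e t)" for t
      have w: "w (e i) = vec_index u i" if "i < N" for i
        using that e by (simp add: w_def the_inv_into_f_f bij_betw_def)
      have "(\<Sum>t\<in>X. eval2 (a r t) x y * w t) = 0" if r: "r \<in> X" for r
      proof -
        obtain i where i: "i < N" "e i = r" using e r unfolding bij_betw_def by force
        have "(\<Sum>t\<in>X. eval2 (a r t) x y * w t) = vec_index (B *\<^sub>v u) i"
          unfolding sum_e using i by (auto simp: mult[OF u(1)] w intro!: sum.cong)
        then show ?thesis using i u(3) by simp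
      qed
      then have "w r = 0" if "r \<in> X" for r using uniq[OF xy] that by blast
      then have "u = 0\<^sub>v N" using u(1) w eX by (intro eq_vecI) auto
      then show False using u(2) by blast
    qed
    define u where "u = Matrix.vec N (\<lambda>i. v x y (e i))"
    have u: "u \<in> carrier_vec N" by (simp add: u_def)
    have "B *\<^sub>v u = Matrix.vec N (\<lambda>i. eval2 (b (e i)) x y)"
      unfolding mult[OF u] using sol[OF xy eX] unfolding sum_e
      by (intro eq_vecI) (auto simp: u_def)
    then have "replace_col B (B *\<^sub>v u) k = map_mat (\<lambda>P. eval2 P x y) R"
      by (intro eq_matI) (auto simp: replace_col_def R_def B_def A_def)
    then have "eval2 (Determinant.det R) x y = vec_index u k * eval2 (Determinant.det A) x y"
      using cramer_lemma_mat[OF B u k(1)] by (simp add: B_def)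
    then show "v x y s = eval2 (Determinant.det R) x y / eval2 (Determinant.det A) x y"
      using nz k by (auto simp: u_def field_simps)
  qed
qed


section \<open>The rally chain\<close>

instance team :: countable by countable_datatype
instance server :: countable by countable_datatype
instance state :: countable by countable_datatype

section \<open>A rally as a step with two outcomes\<close>

fun serving_team :: "server \<Rightarrow> team" where
  "serving_team A_first = Team_A"
| "serving_team A_second = Team_A"
| "serving_team B_first = Team_B"
| "serving_team B_second = Team_B"

definition live_states :: "nat \<Rightarrow> state set" where
  "live_states n = state_space n - range Wins"

text \<open>Polymorphic so that it applies both to real probabilities and to the polynomial
  variables of the linear system. The value at \<open>Wins T\<close> is harmless, since both
  outcomes of a step fix that state.\<close>

fun serve_prob :: "'a :: zero \<Rightarrow> 'a \<Rightarrow> state \<Rightarrow> 'a" where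
  "serve_prob pA pB (Play i j k) = (case serving_team k of Team_A \<Rightarrow> pA | Team_B \<Rightarrow> pB)"
| "serve_prob pA pB (Wins T) = 0"

fun server_wins :: "nat \<Rightarrow> state \<Rightarrow> state" where
  "server_wins n (Play i j k) =
     (case serving_team k of Team_A \<Rightarrow> A_scores_serving n i j k | Team_B \<Rightarrow> B_scores_serving n i j k)"
| "server_wins n (Wins T) = Wins T"

fun server_loses :: "nat \<Rightarrow> state \<Rightarrow> state" where
  "server_loses n (Play i j k) =
     (case serving_team k of Team_A \<Rightarrow> B_wins_receiving n i j k | Team_B \<Rightarrow> A_wins_receiving n i j k)"
| "server_loses n (Wins T) = Wins T"

lemma finite_live_states: "finite (live_states n)"
proof -
  have "(UNIV :: server set) = {A_first, A_second, B_first, B_second}"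
    using server.exhaust by blast
  then have "finite (UNIV :: server set)" by (metis finite.simps)
  moreover have "finite (score_set n)" by (simp add: score_set_def)
  moreover have "live_states n \<subseteq> (\<lambda>(p, k). Play (fst p) (snd p) k) ` (score_set n \<times> UNIV)"
    by (force simp: live_states_def state_space_def)
  ultimately show ?thesis by (meson finite_SigmaI finite_imageI finite_subset)
qed

lemma rally_eq:
  "rally n pA pB s =
     map_pmf (\<lambda>w. if w then server_wins n s else server_loses n s) (bernoulli_pmf (serve_prob pA pB s))"
proof (cases s)
  case (Play i j k)
  then show ?thesis by (cases k) (simp_all cong: if_cong)
qed (simp cong: if_cong)

lemma step_in_state_space:
  assumes "n \<ge> 2" "s \<in> state_space n"
  shows "server_wins n s \<in> state_space n" "server_loses n s \<in> state_space n"
proof -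
  \<comment> \<open>With parameter 1/2 both outcomes of a rally at a playing state have positive
    probability, so the support contains both successors.\<close>
  have "set_pmf (map_pmf (\<lambda>w. if w then server_wins n s else server_loses n s)
      (bernoulli_pmf (serve_prob (1/2) (1/2) s))) \<subseteq> state_space n"
    unfolding rally_eq[symmetric] by (rule set_pmf_rally_subset[OF assms])
  then show "server_wins n s \<in> state_space n" "server_loses n s \<in> state_space n"
    using assms(2) by (cases s; auto split: team.splits)+
qed

lemma expectation_rally:
  assumes "pA \<in> {0..1}" "pB \<in> {0..1}"
  shows "measure_pmf.expectation (rally n pA pB s) v =
    serve_prob pA pB s * v (server_wins n s) + (1 - serve_prob pA pB s) * v (server_loses n s)"
proof -
  have "serve_prob pA pB s \<in> {0..1}" using assms by (cases s) (auto split: team.splits)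
  then show ?thesis unfolding rally_eq by simp
qed


subsection \<open>Harmonic functions\<close>

definition harmonic :: "nat \<Rightarrow> real \<Rightarrow> real \<Rightarrow> (state \<Rightarrow> real) \<Rightarrow> bool" where
  "harmonic n pA pB v \<longleftrightarrow> (\<forall>s\<in>live_states n.
     v s = serve_prob pA pB s * v (server_wins n s) + (1 - serve_prob pA pB s) * v (server_loses n s))"

lemma harmonic_diff:
  assumes "harmonic n pA pB v" "harmonic n pA pB w"
  shows "harmonic n pA pB (\<lambda>s. v s - w s)"
  unfolding harmonic_def
proof
  fix s assume s: "s \<in> live_states n"
  have "v s - w s =
    (serve_prob pA pB s * v (server_wins n s) + (1 - serve_prob pA pB s) * v (server_loses n s)) -
    (serve_prob pA pB s * w (server_wins n s) + (1 - serve_prob pA pB s) * w (server_loses n s))"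
    using assms s unfolding harmonic_def by metis
  then show "v s - w s = serve_prob pA pB s * (v (server_wins n s) - w (server_wins n s)) +
      (1 - serve_prob pA pB s) * (v (server_loses n s) - w (server_loses n s))"
    by (simp add: algebra_simps)
qed

lemma harmonic_const: "harmonic n pA pB (\<lambda>_. c)"
  by (simp add: harmonic_def algebra_simps)

lemma harmonic_hit_prob:
  assumes "pA \<in> {0..1}" "pB \<in> {0..1}"
  shows "harmonic n pA pB (hit_prob (rally n pA pB) (Wins T))"
  unfolding harmonic_def
proof
  fix s assume "s \<in> live_states n"
  then have "s \<noteq> Wins T" by (auto simp: live_states_def)
  then show "hit_prob (rally n pA pB) (Wins T) s =
      serve_prob pA pB s * hit_prob (rally n pA pB) (Wins T) (server_wins n s) +
      (1 - serve_prob pA pB s) * hit_prob (rally n pA pB) (Wins T) (server_loses n s)"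
    using hit_prob_first_step expectation_rally[OF assms] by metis
qed

lemma hit_prob_rally_Wins:
  "hit_prob (rally n pA pB) (Wins T) (Wins T') = of_bool (T = T')"
  by (auto simp: hit_prob_target hit_prob_absorbing)

text \<open>
  A serving streak of Team A raises \<open>i - j\<close> by one per rally, even when the score drops from
  \<open>(n - 1, n)\<close> to \<open>(n - 1, n - 1)\<close>.
\<close>

lemma Team_A_wins_by_serving:
  assumes "n \<ge> 2" "S \<subseteq> state_space n" "serving_team k = Team_A" "Play i j k \<in> S"
    and closed: "\<And>i j k. Play i j k \<in> S \<Longrightarrow> serving_team k = Team_A \<Longrightarrow> server_wins n (Play i j k) \<in> S"
  shows "Wins Team_A \<in> S"
  using assms(3,4)
\<comment> \<open>Scores satisfy \<open>i \<le> n\<close>, so the subtraction is never truncated and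
  the measure falls with every point served out.\<close>
proof (induction "2 * n + j - i" arbitrary: i j rule: less_induct)
  case less
  have "(i, j) \<in> score_set n" using less.prems assms(2) by force
  then have ij: "i < n \<and> j < n \<or> i = n - 1 \<and> j = n \<or> i = n \<and> j = n - 1"
    by (auto simp: score_set_def)
  have next_S: "A_scores_serving n i j k \<in> S"
    using closed[OF less.prems(2,1)] less.prems(1) by simp
  show ?case
  proof (cases "A_scores_serving n i j k")
    case (Play i' j' k')
    with ij assms(1) have "k' = k" "2 * n + j' - i' < 2 * n + j - i"
      by (auto simp: A_scores_serving_def split: if_splits)
    then show ?thesis using less.hyps[OF _ less.prems(1)] next_S Play by simp
  next
    case (Wins T)
    then show ?thesis using next_S by (auto simp: A_scores_serving_def split: if_splits)
  qed
qed

lemma Team_B_wins_by_serving: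
  assumes "n \<ge> 2" "S \<subseteq> state_space n" "serving_team k = Team_B" "Play i j k \<in> S"
    and closed: "\<And>i j k. Play i j k \<in> S \<Longrightarrow> serving_team k = Team_B \<Longrightarrow> server_wins n (Play i j k) \<in> S"
  shows "Wins Team_B \<in> S"
  using assms(3,4)
proof (induction "2 * n + i - j" arbitrary: i j rule: less_induct)
  case less
  have "(i, j) \<in> score_set n" using less.prems assms(2) by force
  then have ij: "i < n \<and> j < n \<or> i = n - 1 \<and> j = n \<or> i = n \<and> j = n - 1"
    by (auto simp: score_set_def)
  have next_S: "B_scores_serving n i j k \<in> S"
    using closed[OF less.prems(2,1)] less.prems(1) by simp
  show ?case
  proof (cases "B_scores_serving n i j k")
    case (Play i' j' k')
    with ij assms(1) have "k' = k" "2 * n + i' - j' < 2 * n + i - j"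
      by (auto simp: B_scores_serving_def split: if_splits)
    then show ?thesis using less.hyps[OF _ less.prems(1)] next_S Play by simp
  next
    case (Wins T)
    then show ?thesis using next_S by (auto simp: B_scores_serving_def split: if_splits)
  qed
qed

text \<open>A rally won by the receivers never ends the game and advances the server; each team has
  two servers, so two successive losses hand the serve over.\<close>

lemma server_change:
  assumes "Play i j k \<in> S"
    and closed: "\<And>i j k. Play i j k \<in> S \<Longrightarrow> serving_team k = T \<Longrightarrow> server_loses n (Play i j k) \<in> S"
  shows "\<exists>i j k. Play i j k \<in> S \<and> serving_team k \<noteq> T"
proof (rule ccontr)
  assume "\<not> ?thesis"
  then have *: "Play i j k \<in> S \<Longrightarrow> serving_team k = T" for i j k by blast
  have "\<exists>i' j'. Play i' j' (next_server k) \<in> S" if "Play i j k \<in> S" for i j k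
    using closed[OF that *[OF that]]
    by (cases k) (auto simp: A_wins_receiving_def B_wins_receiving_def split: if_splits)
  then obtain i' j' i'' j'' where "Play i' j' (next_server k) \<in> S"
      "Play i'' j'' (next_server (next_server k)) \<in> S"
    using assms(1) by meson
  then have "serving_team k = T" "serving_team (next_server (next_server k)) = T"
    using * assms(1) by blast+
  then show False by (cases k) auto
qed

text \<open>
  The states where the maximum is attained are closed under transitions of positive probability,
  hence contain an absorbing state.
\<close>

lemma harmonic_maximum_principle:
  assumes n: "n \<ge> 2" and p: "pA \<in> {0..1}" "pB \<in> {0..1}" "(pA, pB) \<noteq> (0, 0)"
    and harm: "harmonic n pA pB v" and Wins: "\<And>T. v (Wins T) \<le> 0" and s: "s \<in> state_space n"
  shows "v s \<le> 0"
proof (rule ccontr)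
  assume "\<not> v s \<le> 0"
  have "state_space n \<subseteq> live_states n \<union> {Wins Team_A, Wins Team_B}"
    using team.exhaust by (auto simp: live_states_def) 
  then have fin: "finite (state_space n)"
    by (rule finite_subset) (simp add: finite_live_states)
  define M where "M = Max (v ` state_space n)"
  define S where "S = {s \<in> state_space n. v s = M}"
  have le: "v t \<le> M" if "t \<in> state_space n" for t
    using that fin by (simp add: M_def)
  then have "M > 0" using \<open>\<not> v s \<le> 0\<close> s by fastforce
  have "M \<in> v ` state_space n" unfolding M_def using fin s by (intro Max_in) auto
  then obtain s0 where s0: "s0 \<in> S" by (auto simp: S_def)
  have no_Wins: "Wins T \<notin> S" for T using Wins[of T] \<open>M > 0\<close> by (auto simp: S_def)
  have closed: "(serve_prob pA pB t > 0 \<longrightarrow> server_wins n t \<in> S) \<and>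
      (serve_prob pA pB t < 1 \<longrightarrow> server_loses n t \<in> S)" if t: "t \<in> S" for t
  proof -
    define q where "q = serve_prob pA pB t"
    have q: "0 \<le> q" "q \<le> 1" using p by (cases t; auto simp: q_def split: team.splits)+
    have st: "t \<in> state_space n" "t \<in> live_states n"
      using t no_Wins by (auto simp: S_def live_states_def)
    define a b where "a = M - v (server_wins n t)" and "b = M - v (server_loses n t)"
    have ab: "a \<ge> 0" "b \<ge> 0"
      using le step_in_state_space[OF n st(1)] by (auto simp: a_def b_def)
    have "M = q * v (server_wins n t) + (1 - q) * v (server_loses n t)"
      using harm st(2) t unfolding harmonic_def q_def S_def by force
    \<comment> \<open>The deficits \<open>a\<close> and \<open>b\<close> below the maximum are
      nonnegative with weighted mean zero, so every successor of positive weight attains the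
      maximum.\<close>
    then have "q * a + (1 - q) * b = 0" by (simp add: a_def b_def algebra_simps)
    then have "q * a = 0" "(1 - q) * b = 0"
      using q ab by (smt (verit) mult_nonneg_nonneg)+
    then have "q > 0 \<longrightarrow> a = 0" "q < 1 \<longrightarrow> b = 0" by auto
    then show ?thesis
      using step_in_state_space[OF n st(1)] by (auto simp: q_def S_def a_def b_def)
  qed
  have SS: "S \<subseteq> state_space n" by (auto simp: S_def)
  have A: "serving_team k \<noteq> Team_A" if "pA > 0" "Play i j k \<in> S" for i j k
  proof
    assume "serving_team k = Team_A"
    then have "Wins Team_A \<in> S"
      using that closed by (intro Team_A_wins_by_serving[OF n SS]) fastforce+
    then show False using no_Wins by blast
  qed
  have B: "serving_team k \<noteq> Team_B" if "pB > 0" "Play i j k \<in> S" for i j k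
  proof
    assume "serving_team k = Team_B"
    then have "Wins Team_B \<in> S"
      using that closed by (intro Team_B_wins_by_serving[OF n SS]) fastforce+
    then show False using no_Wins by blast
  qed
  obtain i j k where s0_Play: "Play i j k \<in> S" using s0 no_Wins by (cases s0) auto
  show False
  proof (cases "pA > 0")
    case True
    \<comment> \<open>By \<open>A\<close>, Team B serves in the given state of \<open>S\<close>, and
      \<open>B\<close> then excludes a positive \<open>pB\<close>. Team B therefore loses every
      rally on serve, which brings Team A to serve within \<open>S\<close>.\<close>
    then have "pB = 0"  using A B p s0_Play by (cases "serving_team k") force+
    then have "\<exists>i j k. Play i j k \<in> S \<and> serving_team k \<noteq> Team_B"
      using closed by (intro server_change[OF s0_Play]) force
    then show False using A True by (metis team.exhaust)
  next
    case False
    then have "pA = 0" "pB > 0" using p by auto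
    then have "\<exists>i j k. Play i j k \<in> S \<and> serving_team k \<noteq> Team_A"
      using closed by (intro server_change[OF s0_Play]) force
    then show False using B \<open>pB > 0\<close> by (metis team.exhaust)
  qed
qed

text \<open>Apply the maximum principle to both differences, which vanish at the absorbing
  states.\<close>

lemma harmonic_unique:
  assumes "n \<ge> 2" "pA \<in> {0..1}" "pB \<in> {0..1}" "(pA, pB) \<noteq> (0, 0)"
    and "harmonic n pA pB v" "harmonic n pA pB w" "\<And>T. v (Wins T) = w (Wins T)" "s \<in> state_space n"
  shows "v s = w s"
  using harmonic_maximum_principle[OF assms(1-4) harmonic_diff[OF assms(5,6)] _ assms(8)]
    harmonic_maximum_principle[OF assms(1-4) harmonic_diff[OF assms(6,5)] _ assms(8)] assms(7)
  by force

section \<open>Winning probabilities as values of harmonic functions\<close>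

lemma initial_state_live: "n \<ge> 2 \<Longrightarrow> initial_state T \<in> live_states n"
  by (cases T) (auto simp: live_states_def score_set_def)

lemma initial_state_in_state_space: "n \<ge> 2 \<Longrightarrow> initial_state T \<in> state_space n"
  using initial_state_live[of n T] by (simp add: live_states_def)

lemma win_prob_eq_hit_prob:
  "win_prob n pA pB T S = hit_prob (rally n pA pB) (Wins T) (initial_state S)"
  by (simp add: win_prob_def hit_prob_def)

lemma win_prob_sum:
  assumes "n \<ge> 2" "pA \<in> {0..1}" "pB \<in> {0..1}" "(pA, pB) \<noteq> (0, 0)"
  shows "win_prob n pA pB Team_A S + win_prob n pA pB Team_B S = 1"
proof -
  let ?h = "\<lambda>T. hit_prob (rally n pA pB) (Wins T)"
  have "?h Team_A (initial_state S) = 1 - ?h Team_B (initial_state S)"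
  \<comment> \<open>The complement of Team B's winning probability is harmonic too, with Team A's
    values at the absorbing states.\<close>
  proof (rule harmonic_unique[OF assms, where v = "?h Team_A" and w = "\<lambda>s. 1 - ?h Team_B s"])
    show "?h Team_A (Wins T) = 1 - ?h Team_B (Wins T)" for T
      by (cases T) (simp_all add: hit_prob_rally_Wins)
  qed (auto intro!: harmonic_diff harmonic_const harmonic_hit_prob initial_state_in_state_space assms)
  then show ?thesis by (simp add: win_prob_eq_hit_prob)
qed


subsection \<open>Exchanging the teams\<close>

fun other_team :: "team \<Rightarrow> team" where
  "other_team Team_A = Team_B"
| "other_team Team_B = Team_A"

text \<open>Advancing the server twice passes from each server to the same-ranked server of the other team.\<close>

fun swap_teams :: "state \<Rightarrow> state" where
  "swap_teams (Play i j k) = Play j i (next_server (next_server k))"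
| "swap_teams (Wins T) = Wins (other_team T)"

lemma server_wins_swap: "server_wins n (swap_teams s) = swap_teams (server_wins n s)"
proof (cases s)
  case (Play i j k)
  then show ?thesis by (cases k) (auto simp: A_scores_serving_def B_scores_serving_def)
qed auto

lemma server_loses_swap: "server_loses n (swap_teams s) = swap_teams (server_loses n s)"
proof (cases s)
  case (Play i j k)
  then show ?thesis by (cases k) (auto simp: A_wins_receiving_def B_wins_receiving_def)
qed auto

lemma serve_prob_swap: "serve_prob pB pA (swap_teams s) = serve_prob pA pB s"
proof (cases s)
  case (Play i j k)
  then show ?thesis by (cases k) auto
qed auto

lemma swap_live: "s \<in> live_states n \<Longrightarrow> swap_teams s \<in> live_states n"
  by (auto simp: live_states_def state_space_def score_set_def)

lemma harmonic_swap:
  assumes "harmonic n pB pA v"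
  shows "harmonic n pA pB (v \<circ> swap_teams)"
  unfolding harmonic_def
proof
  fix s assume "s \<in> live_states n"
  then have "v (swap_teams s) =
      serve_prob pB pA (swap_teams s) * v (server_wins n (swap_teams s)) +
      (1 - serve_prob pB pA (swap_teams s)) * v (server_loses n (swap_teams s))"
    using assms swap_live unfolding harmonic_def by blast
  then show "(v \<circ> swap_teams) s = serve_prob pA pB s * (v \<circ> swap_teams) (server_wins n s) +
      (1 - serve_prob pA pB s) * (v \<circ> swap_teams) (server_loses n s)"
    by (simp add: server_wins_swap server_loses_swap serve_prob_swap)
qed

text \<open>The hitting probability for \<open>(pB, pA)\<close>, pulled back along
  \<open>swap_teams\<close>, is harmonic for \<open>(pA, pB)\<close> and has the right values at the
  absorbing states.\<close>

lemma win_prob_swap: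
  assumes "n \<ge> 2" "pA \<in> {0..1}" "pB \<in> {0..1}" "(pA, pB) \<noteq> (0, 0)"
  shows "win_prob n pB pA (other_team T) (other_team S) = win_prob n pA pB T S"
proof -
  let ?g = "hit_prob (rally n pB pA) (Wins (other_team T)) \<circ> swap_teams"
  have "?g (initial_state S) = hit_prob (rally n pA pB) (Wins T) (initial_state S)"
  proof (rule harmonic_unique[OF assms, where v = ?g and w = "hit_prob (rally n pA pB) (Wins T)"])
    show "?g (Wins T') = hit_prob (rally n pA pB) (Wins T) (Wins T')" for T'
      by (cases T; cases T') (simp_all add: hit_prob_rally_Wins)
  qed (auto intro!: harmonic_swap harmonic_hit_prob initial_state_in_state_space
      simp del: comp_apply simp: assms assms(2,3)[simplified])
  moreover have "swap_teams (initial_state S) = initial_state (other_team S)" by (cases S) auto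
  ultimately show ?thesis by (simp add: win_prob_eq_hit_prob)
qed


subsection \<open>Rationality\<close>

text \<open>
  The absorption probabilities of the live states solve a linear system: \<open>rally_coeff\<close> is its matrix,
  the identity minus the transitions among live states, and \<open>rally_absorbed\<close> its right-hand side.
  In the notation of \<open>eval2\<close>, \<open>[:[:0, 1:]:]\<close> is the variable \<open>pA\<close> and \<open>[:0, 1:]\<close> is \<open>pB\<close>.
\<close>

definition rally_coeff :: "nat \<Rightarrow> state \<Rightarrow> state \<Rightarrow> real poly poly" where
  "rally_coeff n s t = of_bool (t = s) -
     (serve_prob [:[:0, 1:]:] [:0, 1:] s * of_bool (t = server_wins n s) +
      (1 - serve_prob [:[:0, 1:]:] [:0, 1:] s) * of_bool (t = server_loses n s))"

definition rally_absorbed :: "nat \<Rightarrow> team \<Rightarrow> state \<Rightarrow> real poly poly" where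
  "rally_absorbed n T s =
     serve_prob [:[:0, 1:]:] [:0, 1:] s * of_bool (server_wins n s = Wins T) +
     (1 - serve_prob [:[:0, 1:]:] [:0, 1:] s) * of_bool (server_loses n s = Wins T)"

lemma eval2_serve_prob: "eval2 (serve_prob [:[:0, 1:]:] [:0, 1:] s) x y = serve_prob x y s"
  by (cases s) (auto split: team.splits)

text \<open>Row \<open>s\<close> acts as the identity minus one rally. The sum ranges over live
  states only, so the \<open>of_bool\<close> factors remove absorbing successors.\<close>

lemma sum_rally_coeff:
  assumes "s \<in> live_states n"
  shows "(\<Sum>t\<in>live_states n. eval2 (rally_coeff n s t) x y * w t) = w s -
     (serve_prob x y s * (of_bool (server_wins n s \<in> live_states n) * w (server_wins n s)) +
      (1 - serve_prob x y s) * (of_bool (server_loses n s \<in> live_states n) * w (server_loses n s)))"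
proof -
  have delta: "(\<Sum>t\<in>live_states n. of_bool (t = r) * w t) = of_bool (r \<in> live_states n) * w r" for r
    by (simp add: of_bool_def if_distrib if_distribR finite_live_states cong: if_cong)
  have "(\<Sum>t\<in>live_states n. eval2 (rally_coeff n s t) x y * w t) =
      (\<Sum>t\<in>live_states n. of_bool (t = s) * w t -
        (serve_prob x y s * (of_bool (t = server_wins n s) * w t) +
         (1 - serve_prob x y s) * (of_bool (t = server_loses n s) * w t)))"
    by (intro sum.cong) (simp_all add: rally_coeff_def eval2_serve_prob algebra_simps)
  also have "\<dots> = of_bool (s \<in> live_states n) * w s -
     (serve_prob x y s * (of_bool (server_wins n s \<in> live_states n) * w (server_wins n s)) +
      (1 - serve_prob x y s) * (of_bool (server_loses n s \<in> live_states n) * w (server_loses n s)))"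
    unfolding sum_subtractf sum.distrib sum_distrib_left[symmetric] delta ..
  finally show ?thesis using assms by simp
qed

lemma rational_win_prob:
  assumes n: "n \<ge> 2"
  shows "rational_function_on ({0..1} \<times> {0..1} - {(0, 0)}) (\<lambda>x y. win_prob n x y T S)"
  unfolding win_prob_eq_hit_prob
proof (rule rational_solution_of_linear_system[where X = "live_states n" and a = "rally_coeff n" and
      b = "rally_absorbed n T" and v = "\<lambda>x y. hit_prob (rally n x y) (Wins T)"])
  show "finite (live_states n)" by (rule finite_live_states)
  show "initial_state S \<in> live_states n" using n by (rule initial_state_live)
  have step: "server_wins n s \<in> state_space n" "server_loses n s \<in> state_space n"
    if "s \<in> live_states n" for s
    using that step_in_state_space[OF n, of s] by (auto simp: live_states_def)
  {
    fix x y :: real and s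
    assume xy: "(x, y) \<in> {0..1} \<times> {0..1} - {(0, 0)}" and s: "s \<in> live_states n"
    let ?h = "hit_prob (rally n x y) (Wins T)"
    \<comment> \<open>Splits a successor's value into an unknown of the system and a known boundary
      value, which moves to the right-hand side.\<close>
    have absorbed: "?h r = of_bool (r \<in> live_states n) * ?h r + of_bool (r = Wins T)"
      if "r \<in> state_space n" for r
      using that by (cases r) (auto simp: live_states_def hit_prob_rally_Wins)
    have "?h s = serve_prob x y s * ?h (server_wins n s) + (1 - serve_prob x y s) * ?h (server_loses n s)"
      using harmonic_hit_prob[of x y n T] xy s by (auto simp: harmonic_def)
    also have "\<dots> = serve_prob x y s *
        (of_bool (server_wins n s \<in> live_states n) * ?h (server_wins n s) + of_bool (server_wins n s = Wins T)) +
      (1 - serve_prob x y s) *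
        (of_bool (server_loses n s \<in> live_states n) * ?h (server_loses n s) + of_bool (server_loses n s = Wins T))"
      by (simp only: absorbed[OF step(1)[OF s], symmetric] absorbed[OF step(2)[OF s], symmetric])
    finally show "(\<Sum>t\<in>live_states n. eval2 (rally_coeff n s t) x y * ?h t) =
        eval2 (rally_absorbed n T s) x y"
      unfolding sum_rally_coeff[OF s] rally_absorbed_def
      by (simp add: eval2_serve_prob algebra_simps)
  next
    fix x y :: real and w r
    assume xy: "(x, y) \<in> {0..1} \<times> {0..1} - {(0, 0)}"
      and w: "\<And>s. s \<in> live_states n \<Longrightarrow> (\<Sum>t\<in>live_states n. eval2 (rally_coeff n s t) x y * w t) = 0"
      and r: "r \<in> live_states n"
    \<comment> \<open>Extending a homogeneous solution by zero at the absorbing states gives a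
      harmonic function with zero boundary values, which must be the constant 0.\<close>
    define w' where "w' s = of_bool (s \<in> live_states n) * w s" for s
    have "harmonic n x y w'"
      unfolding harmonic_def
    proof
      fix s assume s: "s \<in> live_states n"
      show "w' s = serve_prob x y s * w' (server_wins n s) + (1 - serve_prob x y s) * w' (server_loses n s)"
        using w[OF s] s unfolding sum_rally_coeff[OF s] w'_def by simp
    qed
    moreover have "w' (Wins T') = 0" for T' by (simp add: w'_def live_states_def)
    ultimately have "w' r = 0"
      using xy r harmonic_unique[OF n _ _ _ _ harmonic_const, of x y w' 0 r]
      by (auto simp: live_states_def)
    then show "w r = 0" using r by (simp add: w'_def)
  }
qed

theorem theorem4:
  fixes n :: nat
  assumes "n \<ge> 3"
  shows "rational_function_on ({0..1} \<times> {0..1} - {(0, 0)}) (f_circ n) \<and>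
    (\<forall>(pA, pB) \<in> {0..1} \<times> {0..1} - {(0, 0)}. f_circ n pA pB = f_circ n pB pA) \<and>
    (\<forall>x \<in> {0<..1}.
       win_prob n x x Team_A Team_A = win_prob n x x Team_B Team_B \<and>
       f_circ n x x = 2 * win_prob n x x Team_A Team_A - 1)"
proof (intro conjI ballI)
  have n: "n \<ge> 2" using assms by simp
  have "f_circ n = (\<lambda>x y. win_prob n x y Team_A Team_A - win_prob n x y Team_A Team_B)"
    by (simp add: f_circ_def fun_eq_iff)
  then show "rational_function_on ({0..1} \<times> {0..1} - {(0, 0)}) (f_circ n)"
    using rational_function_on_diff rational_win_prob[OF n] by presburger
  show "case z of (pA, pB) \<Rightarrow> f_circ n pA pB = f_circ n pB pA"
    if "z \<in> {0..1} \<times> {0..1} - {(0, 0)}" for z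
  proof -
    obtain pA pB where z: "z = (pA, pB)" by fastforce
    with that have p: "pA \<in> {0..1}" "pB \<in> {0..1}" "(pA, pB) \<noteq> (0, 0)" by auto
    have "f_circ n pB pA = win_prob n pA pB Team_B Team_B - win_prob n pA pB Team_B Team_A"
      using win_prob_swap[OF n p, of Team_B Team_B] win_prob_swap[OF n p, of Team_B Team_A]
      by (simp add: f_circ_def)
    then show ?thesis
      using win_prob_sum[OF n p, of Team_A] win_prob_sum[OF n p, of Team_B] by (simp add: z f_circ_def)
  qed
  fix x :: real assume "x \<in> {0<..1}"
  then have p: "x \<in> {0..1}" "x \<in> {0..1}" "(x, x) \<noteq> (0, 0)" by auto
  show eq: "win_prob n x x Team_A Team_A = win_prob n x x Team_B Team_B"
    using win_prob_swap[OF n p, of Team_B Team_B] by simp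
  \<comment> \<open>In the notation \<open>XY\<close> above, AB = 1 - BB = 1 - AA, the last equality
    by \<open>eq\<close>.\<close>
  show "f_circ n x x = 2 * win_prob n x x Team_A Team_A - 1"
    using win_prob_sum[OF n p, of Team_B] eq by (simp add: f_circ_def)
qed

end
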